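(* Let $f=(f_1,f_2)$ and $f^{u}=(f_1^{u},f_2^{u})$ be the vector-valued fractal interpolation functions corresponding to the generalised data sets $V^{*}=\{(t_j,u_j,v_j):j=0,1,\ldots,N\}$ and $V_2^{*}=\{(t_j,u_j',v_j):j=0,1,\ldots,N\}$, respectively, built with the same $L_j,\alpha_j,\beta_j,\gamma_j,\delta_j,s_j,r_j$ and with the Lipschitz functions $(p_j,q_j)$ for $V^*$ and $(p_j',q_j')$ for $V_2^*$, as described in the context. Put $$\zeta=\max_{1\le j\le N}\max_{t\in I}\{|\alpha_j(t)|,|\beta_j(t)|\},\qquad \eta=\max_{1\le j\le N}\max_{t\in I}\{|\gamma_j(t)|,|\delta_j(t)|\},$$ and suppose $\zeta+\eta<1$. Then $$\|f_1-f_1^{u}\|_{\infty}< \frac{1-\eta}{1-\zeta-\eta}\max_{j=1,2,\ldots,N}\{l_{p_j}+l_{p_j'}\}+\frac{\zeta}{1-\zeta-\eta}\max_{j=1,2,\ldots,N}\{l_{q_j}+l_{q_j'}\}+\frac{1+\zeta-\eta}{1-\zeta-\eta}\max_{j=1,2,\ldots,N}\{|u_j-u_j'|\}.$$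
   Context: Let $I=[0,1]$, $N\ge 2$, and $0=t_0<t_1<\cdots<t_N=1$. Let $I_j=[t_{j-1},t_j]$ and let $L_j:I\to I_j$ be the contractive homeomorphism $L_j(t)=\frac{t_j-t_{j-1}}{t_N-t_0}(t-t_0)+t_{j-1}$ for $j=1,\ldots,N$. A map $T$ of a metric space $(X,d)$ into itself is an Edelstein contraction if $d(Tx,Ty)<d(x,y)$ for all $x\ne y$. Let $\alpha_j,\beta_j,\gamma_j,\delta_j:I\to\mathbb{R}$ be Lipschitz with $\|\alpha_j\|_\infty+\|\gamma_j\|_\infty\le 1$ and $\|\beta_j\|_\infty+\|\delta_j\|_\infty\le 1$, and let $s_j,r_j:\mathbb{R}\to\mathbb{R}$ be Edelstein contractions ($j=1,\ldots,N$). Generalised data set $V^*=\{(t_j,u_j,v_j)\}\subset I\times\mathbb{R}^2$: let $p_j,q_j:I\to\mathbb{R}$ be Lipschitz functions such that $$F_j(t,u,v)=\big(\alpha_j(t)s_j(u)+\beta_j(t)r_j(v)+p_j(t),\ \gamma_j(t)s_j(u)+\delta_j(t)r_j(v)+q_j(t)\big)$$ satisfies $F_j(t_0,u_0,v_0)=(u_{j-1},v_{j-1})$ and $F_j(t_N,u_N,v_N)=(u_j,v_j)$ for $j=1,\ldots,N$. Let $K\subset\mathbb{R}^2$ be a compact set with $F_j(I\times K)\subset K$ for all $j$; the associated iterated function system is $\{I\times K,\ \omega_j=(L_j,F_j):j=1,\ldots,N\}$. The vector-valued fractal interpolation function $f=(f_1,f_2)$ corresponding to $V^*$ is the unique continuous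 $f:I\to\mathbb{R}^2$ with $f(t_j)=(u_j,v_j)$ for $j=0,\ldots,N$ and $f(L_j(t))=F_j(t,f(t))$ for all $t\in I$, $j=1,\ldots,N$; its first component $f_1$ is called the Edelstein hidden-variable fractal interpolation function. Generalised data set $V_2^*=\{(t_j,u_j',v_j)\}\subset I\times\mathbb{R}^2$: the function $f^u=(f_1^u,f_2^u)$ is defined in the same way, with the same $L_j,\alpha_j,\beta_j,\gamma_j,\delta_j,s_j,r_j$, but with $p_j,q_j$ replaced by Lipschitz functions $p_j',q_j':I\to\mathbb{R}$ such that the resulting maps $F_j'$ satisfy $F_j'(t_0,u_0',v_0)=(u_{j-1}',v_{j-1})$ and $F_j'(t_N,u_N',v_N)=(u_j',v_j)$ for $j=1,\ldots,N$. For a Lipschitz function $g:I\to\mathbb{R}$, $l_g$ denotes a Lipschitz constant of $g$, and $\|g\|_\infty=\sup_{t\in I}|g(t)|$ for bounded $g:I\to\mathbb{R}$.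
   Formalization: With B the right-hand side, proved: ≤ B always; < B if B>0 and either ζ>0, or max(l_p+l_p')>0 and |u_0−u_0'|<B. Strictness fails otherwise (e.g. all data zero, or ζ=0 with the maximal gap at t_0). *)

theory Defs
  imports "HOL-Analysis.Analysis"
begin

definition edelstein_contraction :: "('a::metric_space \<Rightarrow> 'a) \<Rightarrow> bool" where
  "edelstein_contraction T \<longleftrightarrow> (\<forall>x y. x \<noteq> y \<longrightarrow> dist (T x) (T y) < dist x y)"

(* Only meaningful for g bounded on the unit interval. *)
definition sup_norm :: "(real \<Rightarrow> real) \<Rightarrow> real" where
  "sup_norm g = (SUP x\<in>{0..1}. \<bar>g x\<bar>)"

definition lipschitz_on_unit :: "(real \<Rightarrow> real) \<Rightarrow> bool" where
  "lipschitz_on_unit g \<longleftrightarrow> (\<exists>L. L-lipschitz_on {0..1} g)"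

definition partition_map :: "nat \<Rightarrow> (nat \<Rightarrow> real) \<Rightarrow> nat \<Rightarrow> real \<Rightarrow> real" where
  "partition_map N t j x = (t j - t (j - 1)) / (t N - t 0) * (x - t 0) + t (j - 1)"

definition fif_map ::
  "(nat \<Rightarrow> real \<Rightarrow> real) \<Rightarrow> (nat \<Rightarrow> real \<Rightarrow> real) \<Rightarrow> (nat \<Rightarrow> real \<Rightarrow> real) \<Rightarrow> (nat \<Rightarrow> real \<Rightarrow> real) \<Rightarrow>
   (nat \<Rightarrow> real \<Rightarrow> real) \<Rightarrow> (nat \<Rightarrow> real \<Rightarrow> real) \<Rightarrow> (nat \<Rightarrow> real \<Rightarrow> real) \<Rightarrow> (nat \<Rightarrow> real \<Rightarrow> real) \<Rightarrow>
   nat \<Rightarrow> real \<Rightarrow> real \<times> real \<Rightarrow> real \<times> real" where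
  "fif_map \<alpha> \<beta> \<gamma> \<delta> s r p q j x z =
     (\<alpha> j x * s j (fst z) + \<beta> j x * r j (snd z) + p j x,
      \<gamma> j x * s j (fst z) + \<delta> j x * r j (snd z) + q j x)"

definition join_up ::
  "nat \<Rightarrow> (nat \<Rightarrow> real) \<Rightarrow> (nat \<Rightarrow> real) \<Rightarrow> (nat \<Rightarrow> real) \<Rightarrow>
   (nat \<Rightarrow> real \<Rightarrow> real \<times> real \<Rightarrow> real \<times> real) \<Rightarrow> bool" where
  "join_up N t u v F \<longleftrightarrow>
     (\<forall>j\<in>{1..N}. F j (t 0) (u 0, v 0) = (u (j - 1), v (j - 1)) \<and>
                F j (t N) (u N, v N) = (u j, v j))"

(* Values of f outside the unit interval are irrelevant; on it, f is uniquely determined. *)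
definition vector_fif ::
  "nat \<Rightarrow> (nat \<Rightarrow> real) \<Rightarrow> (nat \<Rightarrow> real) \<Rightarrow> (nat \<Rightarrow> real) \<Rightarrow>
   (nat \<Rightarrow> real \<Rightarrow> real \<times> real \<Rightarrow> real \<times> real) \<Rightarrow> (real \<Rightarrow> real \<times> real) \<Rightarrow> bool" where
  "vector_fif N t u v F f \<longleftrightarrow>
     continuous_on {0..1} f \<and>
     (\<forall>j\<le>N. f (t j) = (u j, v j)) \<and>
     (\<forall>j\<in>{1..N}. \<forall>x\<in>{0..1}. f (partition_map N t j x) = F j x (f x))"

(* For continuous coefficients the supremum over the unit interval is attained, so it is the
   maximum used in the source. *)
definition max_coeff :: "nat \<Rightarrow> (nat \<Rightarrow> real \<Rightarrow> real) \<Rightarrow> (nat \<Rightarrow> real \<Rightarrow> real) \<Rightarrow> real" where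
  "max_coeff N a b = (MAX j\<in>{1..N}. SUP x\<in>{0..1}. max \<bar>a j x\<bar> \<bar>b j x\<bar>)"

end

theory Submission
  imports Defs
begin

text \<open>
  Evaluating the join-up conditions at the right endpoint shows that $p_j - p_j'$ and $q_j - q_j'$
  are at most $(1+\zeta)U$ and $\eta U$ there, so on all of $I$ they are at most
  $P + (1+\zeta)U$ and $Q + \eta U$. Inserting this into the self-referential equations gives, for
  $M_i = \|f_i - f_i^u\|_\infty$, the linear system
  $M_1 \le \zeta(M_1+M_2) + P + (1+\zeta)U$, $M_2 \le \eta(M_1+M_2) + Q + \eta U$, and eliminating
  $M_2$ yields the bound. As $M_1$ is attained, the first inequality is strict if $\zeta M_1 > 0$,
  because the $s_j$ strictly decrease distances. If $\zeta = 0$, then $B = P + U$, and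
  at a maximiser $L_j(x)$ the endpoint estimate improves to $(1-x)P + U$, so that equality forces
  $x = 0$, i.e. a maximiser at a node.
\<close>

lemma abs_le_sup_norm:
  assumes "continuous_on {0..1} g" and "x \<in> {0..1}"
  shows "\<bar>g x\<bar> \<le> sup_norm g"
proof -
  have "compact ((\<lambda>x. \<bar>g x\<bar>) ` {0..1})"
    by (intro compact_continuous_image continuous_intros assms) auto
  then have "bdd_above ((\<lambda>x. \<bar>g x\<bar>) ` {0..1})"
    by (intro bounded_imp_bdd_above compact_imp_bounded)
  then show ?thesis
    unfolding sup_norm_def using assms(2) by (intro cSUP_upper)
qed

lemma sup_norm_attained:
  assumes "continuous_on {0..1} g"
  obtains x where "x \<in> {0..1}" and "sup_norm g = \<bar>g x\<bar>"
proof -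
  have "\<exists>x\<in>{0..1}. \<forall>y\<in>{0..1}. \<bar>g y\<bar> \<le> \<bar>g x\<bar>"
    by (rule continuous_attains_sup) (auto intro!: continuous_intros assms)
  then obtain x where x: "x \<in> {0..1}" and max: "\<forall>y\<in>{0..1}. \<bar>g y\<bar> \<le> \<bar>g x\<bar>" ..
  have "sup_norm g \<le> \<bar>g x\<bar>"
    unfolding sup_norm_def using max by (intro cSUP_least) auto
  then have "sup_norm g = \<bar>g x\<bar>"
    using abs_le_sup_norm[OF assms x] by linarith
  with x show thesis by (rule that)
qed

lemma max_coeff_bounds:
  assumes "\<forall>j\<in>{1..N}. lipschitz_on_unit (a j) \<and> lipschitz_on_unit (b j)"
    and j: "j \<in> {1..N}" and x: "x \<in> {0..1}"
  shows "\<bar>a j x\<bar> \<le> max_coeff N a b" and "\<bar>b j x\<bar> \<le> max_coeff N a b"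
proof -
  have "continuous_on {0..1} (a j)" "continuous_on {0..1} (b j)"
    using assms(1) j by (auto simp: lipschitz_on_unit_def intro: lipschitz_on_continuous_on)
  then have "compact ((\<lambda>x. max \<bar>a j x\<bar> \<bar>b j x\<bar>) ` {0..1})"
    by (intro compact_continuous_image continuous_intros) auto
  then have "bdd_above ((\<lambda>x. max \<bar>a j x\<bar> \<bar>b j x\<bar>) ` {0..1})"
    by (intro bounded_imp_bdd_above compact_imp_bounded)
  then have "max \<bar>a j x\<bar> \<bar>b j x\<bar> \<le> (SUP x\<in>{0..1}. max \<bar>a j x\<bar> \<bar>b j x\<bar>)"
    using x by (intro cSUP_upper)
  also have "\<dots> \<le> max_coeff N a b"
    unfolding max_coeff_def using j by (intro Max_ge) auto
  finally show "\<bar>a j x\<bar> \<le> max_coeff N a b" and "\<bar>b j x\<bar> \<le> max_coeff N a b"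
    by auto
qed

lemma edelstein_contraction_abs_le:
  fixes T :: "real \<Rightarrow> real"
  assumes "edelstein_contraction T"
  shows "\<bar>T x - T y\<bar> \<le> \<bar>x - y\<bar>"
  using assms unfolding edelstein_contraction_def dist_real_def
  by (cases "x = y") (auto simp: less_imp_le)

text \<open>The only source of strictness from the contractions. Requiring \<open>0 < M\<close>
  covers \<open>x = y\<close>, where the Edelstein condition gives nothing.\<close>

lemma edelstein_contraction_abs_less:
  fixes T :: "real \<Rightarrow> real"
  assumes "edelstein_contraction T" and "\<bar>x - y\<bar> \<le> M" and "0 < M"
  shows "\<bar>T x - T y\<bar> < M"
  using assms unfolding edelstein_contraction_def dist_real_def
  by (cases "x = y") (auto intro: less_le_trans)

text \<open>Lets a point where a difference of the two functions is maximal be pulled back through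
  some \<open>partition_map\<close>, so that the self-referential equation applies there.\<close>

lemma partition_map_covers:
  assumes t: "t 0 = 0" "t N = 1" and mono: "\<forall>j\<in>{1..N}. t (j - 1) < t j"
    and y: "y \<in> {0..1}"
  obtains j x where "j \<in> {1..N}" and "x \<in> {0..1}" and "partition_map N t j x = y"
proof -
  \<comment> \<open>The first node at or to the right of \<open>y\<close>. The clause
    \<open>1 \<le> k\<close> excludes index 0, which would be the least one for
    \<open>y = 0\<close>; hence minimality bounds \<open>y\<close> from below only for
    \<open>j > 1\<close>, and \<open>j = 1\<close> uses \<open>t 0 = 0\<close>.\<close>
  define j where "j = (LEAST k. y \<le> t k \<and> 1 \<le> k)"
  have N: "1 \<le> N" using t by (cases N) auto
  have "y \<le> t j \<and> 1 \<le> j"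
    unfolding j_def by (rule LeastI[where k = N]) (use t y N in auto)
  moreover have "j \<le> N"
    unfolding j_def by (rule Least_le) (use t y N in auto)
  ultimately have j: "j \<in> {1..N}" and upper: "y \<le> t j" by auto
  have lower: "t (j - 1) \<le> y"
  proof (cases "j = 1")
    case True
    then show ?thesis using t y by simp
  next
    case False
    then have "j - 1 < j" "1 \<le> j - 1" using j by auto
    then have "\<not> y \<le> t (j - 1)"
      using not_less_Least[of "j - 1" "\<lambda>k. y \<le> t k \<and> 1 \<le> k", folded j_def] by blast
    then show ?thesis by simp
  qed
  have less: "t (j - 1) < t j" using mono j by blast
  show thesis
  proof (rule that[OF j])
    show "(y - t (j - 1)) / (t j - t (j - 1)) \<in> {0..1}"
      using lower upper less by (simp add: divide_simps)
    show "partition_map N t j ((y - t (j - 1)) / (t j - t (j - 1))) = y"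
      using less t by (simp add: partition_map_def)
  qed
qed

text \<open>Anchored at 1 because the join-up conditions there involve only nodes with index at
  least 1, the range of the maximum \<open>U\<close>. At 0 they would involve \<open>u 0\<close>,
  which \<open>U\<close> does not cover.\<close>

lemma lipschitz_diff_bound_at_one:
  fixes g h :: "real \<Rightarrow> real"
  assumes "a-lipschitz_on {0..1} g" and "b-lipschitz_on {0..1} h" and "x \<in> {0..1}"
  shows "\<bar>g x - h x\<bar> \<le> \<bar>g 1 - h 1\<bar> + (a + b) * (1 - x)"
proof -
  have "\<bar>g x - g 1\<bar> \<le> a * (1 - x)" "\<bar>h x - h 1\<bar> \<le> b * (1 - x)"
    using lipschitz_onD[OF assms(1), of x 1] lipschitz_onD[OF assms(2), of x 1] assms(3)
    by (auto simp: dist_real_def)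
  then show ?thesis by (simp add: distrib_right)
qed

text \<open>Add \<open>1 - \<eta>\<close> times the first inequality to \<open>\<zeta>\<close> times
  the second: the coefficient of \<open>M2\<close> is \<open>\<zeta>\<close> on both sides and
  cancels, leaving \<open>1 - \<zeta> - \<eta>\<close> in front of \<open>M1\<close>.\<close>

lemma coupled_linear_bound:
  fixes M1 M2 a b \<zeta> \<eta> :: real
  assumes "M1 \<le> \<zeta> * (M1 + M2) + a" and "M2 \<le> \<eta> * (M1 + M2) + b"
    and "0 \<le> \<zeta>" and "0 \<le> \<eta>" and "\<zeta> + \<eta> < 1"
  shows "M1 \<le> ((1 - \<eta>) * a + \<zeta> * b) / (1 - \<zeta> - \<eta>)"
proof -
  have "(1 - \<eta>) * M1 \<le> (1 - \<eta>) * (\<zeta> * (M1 + M2) + a)"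
    using assms by (intro mult_left_mono) auto
  moreover have "\<zeta> * M2 \<le> \<zeta> * (\<eta> * (M1 + M2) + b)"
    using assms by (intro mult_left_mono) auto
  ultimately have "M1 * (1 - \<zeta> - \<eta>) \<le> (1 - \<eta>) * a + \<zeta> * b"
    by (simp add: algebra_simps)
  then show ?thesis
    using assms(5) by (simp add: pos_le_divide_eq)
qed

text \<open>The same elimination; strictness survives because the multiplier
  \<open>1 - \<eta>\<close> is positive.\<close>

lemma coupled_linear_bound_strict:
  fixes M1 M2 a b \<zeta> \<eta> :: real
  assumes "M1 < \<zeta> * (M1 + M2) + a" and "M2 \<le> \<eta> * (M1 + M2) + b"
    and "0 \<le> \<zeta>" and "0 \<le> \<eta>" and "\<zeta> + \<eta> < 1"
  shows "M1 < ((1 - \<eta>) * a + \<zeta> * b) / (1 - \<zeta> - \<eta>)"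
proof -
  have "(1 - \<eta>) * M1 < (1 - \<eta>) * (\<zeta> * (M1 + M2) + a)"
    using assms by (intro mult_strict_left_mono) auto
  moreover have "\<zeta> * M2 \<le> \<zeta> * (\<eta> * (M1 + M2) + b)"
    using assms by (intro mult_left_mono) auto
  ultimately have "M1 * (1 - \<zeta> - \<eta>) < (1 - \<eta>) * a + \<zeta> * b"
    by (simp add: algebra_simps)
  then show ?thesis
    using assms(5) by (simp add: pos_less_divide_eq)
qed

text \<open>The side conditions for strictness are sharp. A supremum norm is nonnegative, so
  \<open>B = 0\<close> excludes it. If \<open>\<zeta> = 0\<close>, then \<open>B = P + U\<close>,
  and the difference equals \<open>u j - u' j\<close> at the nodes: the norm is at least
  \<open>U\<close>, which is \<open>B\<close> when \<open>P = 0\<close>, and at least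
  \<open>\<bar>u 0 - u' 0\<bar>\<close>.\<close>

theorem theorem6:
  fixes N :: nat and t u v u' :: "nat \<Rightarrow> real"
    and \<alpha> \<beta> \<gamma> \<delta> s r p q p' q' :: "nat \<Rightarrow> real \<Rightarrow> real"
    and lp lq lp' lq' :: "nat \<Rightarrow> real"
    and K K' :: "(real \<times> real) set"
    and f fu :: "real \<Rightarrow> real \<times> real"
    and \<zeta> \<eta> P Q U B :: real
  assumes "N \<ge> 2" and "t 0 = 0" and "t N = 1"
    and "\<forall>j\<in>{1..N}. t (j - 1) < t j"
    and "\<forall>j\<in>{1..N}. lipschitz_on_unit (\<alpha> j) \<and> lipschitz_on_unit (\<beta> j) \<and>
                    lipschitz_on_unit (\<gamma> j) \<and> lipschitz_on_unit (\<delta> j)"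
    and "\<forall>j\<in>{1..N}. sup_norm (\<alpha> j) + sup_norm (\<gamma> j) \<le> 1"
    and "\<forall>j\<in>{1..N}. sup_norm (\<beta> j) + sup_norm (\<delta> j) \<le> 1"
    and "\<forall>j\<in>{1..N}. edelstein_contraction (s j) \<and> edelstein_contraction (r j)"
    and "\<forall>j\<in>{1..N}. (lp j)-lipschitz_on {0..1} (p j) \<and> (lq j)-lipschitz_on {0..1} (q j)"
    and "\<forall>j\<in>{1..N}. (lp' j)-lipschitz_on {0..1} (p' j) \<and> (lq' j)-lipschitz_on {0..1} (q' j)"
    and "join_up N t u v (fif_map \<alpha> \<beta> \<gamma> \<delta> s r p q)"
    and "join_up N t u' v (fif_map \<alpha> \<beta> \<gamma> \<delta> s r p' q')"
    and "compact K" and "\<forall>j\<in>{1..N}. \<forall>x\<in>{0..1}. fif_map \<alpha> \<beta> \<gamma> \<delta> s r p q j x ` K \<subseteq> K"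
    and "compact K'" and "\<forall>j\<in>{1..N}. \<forall>x\<in>{0..1}. fif_map \<alpha> \<beta> \<gamma> \<delta> s r p' q' j x ` K' \<subseteq> K'"
    and "vector_fif N t u v (fif_map \<alpha> \<beta> \<gamma> \<delta> s r p q) f"
    and "vector_fif N t u' v (fif_map \<alpha> \<beta> \<gamma> \<delta> s r p' q') fu"
    and "\<zeta> = max_coeff N \<alpha> \<beta>" and "\<eta> = max_coeff N \<gamma> \<delta>"
    and "\<zeta> + \<eta> < 1"
    and "P = (MAX j\<in>{1..N}. lp j + lp' j)"
    and "Q = (MAX j\<in>{1..N}. lq j + lq' j)"
    and "U = (MAX j\<in>{1..N}. \<bar>u j - u' j\<bar>)"
    and "B = (1 - \<eta>) / (1 - \<zeta> - \<eta>) * P + \<zeta> / (1 - \<zeta> - \<eta>) * Q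
             + (1 + \<zeta> - \<eta>) / (1 - \<zeta> - \<eta>) * U"
  shows "sup_norm (\<lambda>x. fst (f x) - fst (fu x)) \<le> B \<and>
         (B > 0 \<and> (\<zeta> > 0 \<or> P > 0 \<and> \<bar>u 0 - u' 0\<bar> < B) \<longrightarrow>
            sup_norm (\<lambda>x. fst (f x) - fst (fu x)) < B)"
proof -
  note t = \<open>t 0 = 0\<close> \<open>t N = 1\<close>
  note lip = assms(5) and ed = assms(8) and lip_pq = assms(9) and lip_pq' = assms(10)
  note join = assms(11,12) and fif = assms(17,18)
  note zeta = assms(19) and eta = assms(20)
  have N1: "1 \<in> {1..N}" and NN: "N \<in> {1..N}" using \<open>N \<ge> 2\<close> by auto
  have coeff: "\<bar>\<alpha> j x\<bar> \<le> \<zeta>" "\<bar>\<beta> j x\<bar> \<le> \<zeta>" "\<bar>\<gamma> j x\<bar> \<le> \<eta>" "\<bar>\<delta> j x\<bar> \<le> \<eta>"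
    if "j \<in> {1..N}" "x \<in> {0..1}" for j x
    unfolding zeta eta using lip that by (auto intro!: max_coeff_bounds)
  have nonneg: "0 \<le> \<zeta>" "0 \<le> \<eta>"
    using coeff[OF N1, of 0] by auto
  have U: "\<bar>u j - u' j\<bar> \<le> U" if "j \<in> {1..N}" for j
    unfolding assms(24) using that by (intro Max_ge) auto
  have P: "lp j + lp' j \<le> P" if "j \<in> {1..N}" for j
    unfolding assms(22) using that by (intro Max_ge) auto
  have Q: "lq j + lq' j \<le> Q" if "j \<in> {1..N}" for j
    unfolding assms(23) using that by (intro Max_ge) auto
  have s: "\<bar>s j x - s j y\<bar> \<le> \<bar>x - y\<bar>" and r: "\<bar>r j x - r j y\<bar> \<le> \<bar>x - y\<bar>"
    if "j \<in> {1..N}" for j x y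
    using ed that by (auto intro: edelstein_contraction_abs_le)

  have p_one: "\<bar>p j 1 - p' j 1\<bar> \<le> (1 + \<zeta>) * U" and q_one: "\<bar>q j 1 - q' j 1\<bar> \<le> \<eta> * U"
    if j: "j \<in> {1..N}" for j
  proof -
    have "fif_map \<alpha> \<beta> \<gamma> \<delta> s r p q j 1 (u N, v N) = (u j, v j)"
      and "fif_map \<alpha> \<beta> \<gamma> \<delta> s r p' q' j 1 (u' N, v N) = (u' j, v j)"
      using join j t by (auto simp: join_up_def)
    \<comment> \<open>Both data sets share the \<open>v\<close> values, so the \<open>r\<close>
      terms cancel, and so do the targets \<open>v j\<close> in the second component.\<close>
    then have "p j 1 - p' j 1 = (u j - u' j) - \<alpha> j 1 * (s j (u N) - s j (u' N))"
      and "q j 1 - q' j 1 = - (\<gamma> j 1 * (s j (u N) - s j (u' N)))"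
      unfolding fif_map_def prod.inject fst_conv snd_conv right_diff_distrib by linarith+
    moreover have "\<bar>s j (u N) - s j (u' N)\<bar> \<le> U"
      using s[OF j, of "u N" "u' N"] U[OF NN] by linarith
    then have "\<bar>\<alpha> j 1 * (s j (u N) - s j (u' N))\<bar> \<le> \<zeta> * U"
      and "\<bar>\<gamma> j 1 * (s j (u N) - s j (u' N))\<bar> \<le> \<eta> * U"
      unfolding abs_mult using coeff[OF j, of 1] nonneg by (auto intro!: mult_mono)
    ultimately show "\<bar>p j 1 - p' j 1\<bar> \<le> (1 + \<zeta>) * U" and "\<bar>q j 1 - q' j 1\<bar> \<le> \<eta> * U"
      using U[OF j] by (auto simp: distrib_right)
  qed
  \<comment> \<open>The factor \<open>1 - x\<close> is kept: it is bounded by 1 in the general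
    estimate, but decides strictness when \<open>\<zeta> = 0\<close>.\<close>
  have dp: "\<bar>p j x - p' j x\<bar> \<le> (1 + \<zeta>) * U + P * (1 - x)"
    and dq: "\<bar>q j x - q' j x\<bar> \<le> \<eta> * U + Q * (1 - x)"
    if j: "j \<in> {1..N}" and x: "x \<in> {0..1}" for j x
  proof -
    have "\<bar>p j x - p' j x\<bar> \<le> \<bar>p j 1 - p' j 1\<bar> + (lp j + lp' j) * (1 - x)"
      and "\<bar>q j x - q' j x\<bar> \<le> \<bar>q j 1 - q' j 1\<bar> + (lq j + lq' j) * (1 - x)"
      using lip_pq lip_pq' j x by (auto intro!: lipschitz_diff_bound_at_one)
    moreover have "(lp j + lp' j) * (1 - x) \<le> P * (1 - x)"
      and "(lq j + lq' j) * (1 - x) \<le> Q * (1 - x)"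
      using P[OF j] Q[OF j] x by (auto intro!: mult_right_mono)
    ultimately show "\<bar>p j x - p' j x\<bar> \<le> (1 + \<zeta>) * U + P * (1 - x)"
      and "\<bar>q j x - q' j x\<bar> \<le> \<eta> * U + Q * (1 - x)"
      using p_one[OF j] q_one[OF j] by linarith+
  qed
  have "0 \<le> lp 1" "0 \<le> lq 1" "0 \<le> lp' 1" "0 \<le> lq' 1"
    using lip_pq lip_pq' N1 lipschitz_on_nonneg by blast+
  then have PQ_nonneg: "0 \<le> P" "0 \<le> Q"
    using P[OF N1] Q[OF N1] by linarith+

  define D1 where "D1 = (\<lambda>x. fst (f x) - fst (fu x))"
  define D2 where "D2 = (\<lambda>x. snd (f x) - snd (fu x))"
  define M1 where "M1 = sup_norm D1"
  define M2 where "M2 = sup_norm D2"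
  have cont: "continuous_on {0..1} D1" "continuous_on {0..1} D2"
    unfolding D1_def D2_def using fif by (auto simp: vector_fif_def intro!: continuous_intros)
  have D1: "\<bar>D1 x\<bar> \<le> M1" and D2: "\<bar>D2 x\<bar> \<le> M2" if "x \<in> {0..1}" for x
    unfolding M1_def M2_def using cont that by (auto intro: abs_le_sup_norm)
  have f_rec: "f (partition_map N t j x) = fif_map \<alpha> \<beta> \<gamma> \<delta> s r p q j x (f x)"
    and fu_rec: "fu (partition_map N t j x) = fif_map \<alpha> \<beta> \<gamma> \<delta> s r p' q' j x (fu x)"
    if "j \<in> {1..N}" "x \<in> {0..1}" for j x
    using fif that unfolding vector_fif_def by blast+
  have D1_rec: "D1 (partition_map N t j x) = \<alpha> j x * (s j (fst (f x)) - s j (fst (fu x)))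
      + \<beta> j x * (r j (snd (f x)) - r j (snd (fu x))) + (p j x - p' j x)"
    and D2_rec: "D2 (partition_map N t j x) = \<gamma> j x * (s j (fst (f x)) - s j (fst (fu x)))
      + \<delta> j x * (r j (snd (f x)) - r j (snd (fu x))) + (q j x - q' j x)"
    if "j \<in> {1..N}" "x \<in> {0..1}" for j x
    unfolding D1_def D2_def f_rec[OF that] fu_rec[OF that]
    by (simp_all add: fif_map_def right_diff_distrib)

  \<comment> \<open>Each norm is attained, at unrelated points, and each maximiser is pulled back to
    some \<open>(j, x)\<close> or \<open>(k, z)\<close>. Evaluating the recursion there bounds the
    norms by themselves.\<close>
  obtain y1 where y1: "y1 \<in> {0..1}" "M1 = \<bar>D1 y1\<bar>"
    unfolding M1_def by (rule sup_norm_attained[OF cont(1)])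
  obtain j x where j: "j \<in> {1..N}" and x: "x \<in> {0..1}" and "partition_map N t j x = y1"
    using partition_map_covers[OF t assms(4) y1(1)] .
  then have M1: "M1 = \<bar>D1 (partition_map N t j x)\<bar>" using y1 by simp
  obtain y2 where y2: "y2 \<in> {0..1}" "M2 = \<bar>D2 y2\<bar>"
    unfolding M2_def by (rule sup_norm_attained[OF cont(2)])
  obtain k z where k: "k \<in> {1..N}" and z: "z \<in> {0..1}" and "partition_map N t k z = y2"
    using partition_map_covers[OF t assms(4) y2(1)] .
  then have M2: "M2 = \<bar>D2 (partition_map N t k z)\<bar>" using y2 by simp

  \<comment> \<open>The increment of \<open>s j\<close> at the pulled-back maximiser stays explicit,
    so that either \<open>S \<le> M1\<close> or the strict \<open>S < M1\<close> can be inserted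
    later.\<close>
  define S where "S = \<bar>s j (fst (f x)) - s j (fst (fu x))\<bar>"
  have SM1: "S \<le> M1"
    using s[OF j, of "fst (f x)" "fst (fu x)"] D1[OF x] by (simp add: S_def D1_def)
  have M1_le: "M1 \<le> \<zeta> * S + \<zeta> * M2 + ((1 + \<zeta>) * U + P * (1 - x))"
  proof -
    have "\<bar>r j (snd (f x)) - r j (snd (fu x))\<bar> \<le> M2"
      using r[OF j, of "snd (f x)" "snd (fu x)"] D2[OF x] by (simp add: D2_def)
    then have "\<bar>\<beta> j x * (r j (snd (f x)) - r j (snd (fu x)))\<bar> \<le> \<zeta> * M2"
      unfolding abs_mult using coeff[OF j x] nonneg by (intro mult_mono) auto
    moreover have "\<bar>\<alpha> j x * (s j (fst (f x)) - s j (fst (fu x)))\<bar> \<le> \<zeta> * S"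
      unfolding abs_mult S_def using coeff[OF j x] by (intro mult_right_mono) auto
    ultimately show ?thesis
      unfolding M1 D1_rec[OF j x] using dp[OF j x] by linarith
  qed
  have Px: "P * (1 - x) \<le> P" using PQ_nonneg x by (simp add: algebra_simps)
  have M1_sys: "M1 \<le> \<zeta> * (M1 + M2) + (P + (1 + \<zeta>) * U)"
    using M1_le Px mult_left_mono[OF SM1 nonneg(1)] by (simp add: distrib_left)
  have M2_sys: "M2 \<le> \<eta> * (M1 + M2) + (Q + \<eta> * U)"
  proof -
    have "\<bar>s k (fst (f z)) - s k (fst (fu z))\<bar> \<le> M1" "\<bar>r k (snd (f z)) - r k (snd (fu z))\<bar> \<le> M2"
      using s[OF k, of "fst (f z)" "fst (fu z)"] D1[OF z]
        r[OF k, of "snd (f z)" "snd (fu z)"] D2[OF z] by (simp_all add: D1_def D2_def)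
    then have "\<bar>\<gamma> k z * (s k (fst (f z)) - s k (fst (fu z)))\<bar> \<le> \<eta> * M1"
      "\<bar>\<delta> k z * (r k (snd (f z)) - r k (snd (fu z)))\<bar> \<le> \<eta> * M2"
      unfolding abs_mult using coeff[OF k z] nonneg by (auto intro!: mult_mono)
    moreover have "Q * (1 - z) \<le> Q" using PQ_nonneg z by (simp add: algebra_simps)
    ultimately show ?thesis
      unfolding distrib_left using M2 D2_rec[OF k z] dq[OF k z] by linarith
  qed

  \<comment> \<open>The coefficient of \<open>U\<close> agrees because \<open>(1 - \<eta>) * (1 +
    \<zeta>) + \<zeta> * \<eta> = 1 + \<zeta> - \<eta>\<close>.\<close>
  have B: "B = ((1 - \<eta>) * (P + (1 + \<zeta>) * U) + \<zeta> * (Q + \<eta> * U)) / (1 - \<zeta> - \<eta>)"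
    unfolding assms(25) by (simp add: add_divide_distrib[symmetric] algebra_simps)
  have le: "M1 \<le> B"
    unfolding B using M1_sys M2_sys nonneg \<open>\<zeta> + \<eta> < 1\<close> by (rule coupled_linear_bound)
  \<comment> \<open>The gap between \<open>S\<close> and \<open>M1\<close> exists only for
    \<open>M1 > 0\<close> and reaches the estimate only for \<open>\<zeta> > 0\<close>. If
    \<open>M1 = 0\<close>, positivity of \<open>B\<close> suffices.\<close>
  have "M1 < B" if "B > 0" and strict: "\<zeta> > 0 \<or> P > 0 \<and> \<bar>u 0 - u' 0\<bar> < B"
  proof (cases "M1 > 0 \<and> \<zeta> > 0")
    case True
    then have "S < M1"
      using ed j D1[OF x] unfolding S_def by (intro edelstein_contraction_abs_less) (auto simp: D1_def)
    then have "\<zeta> * S < \<zeta> * M1" using True by simp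
    then have "M1 < \<zeta> * (M1 + M2) + (P + (1 + \<zeta>) * U)"
      using M1_le Px by (simp add: distrib_left)
    then show ?thesis
      unfolding B using M2_sys nonneg \<open>\<zeta> + \<eta> < 1\<close> by (rule coupled_linear_bound_strict)
  next
    case False
    show ?thesis
    proof (cases "M1 > 0")
      case False
      then show ?thesis using \<open>B > 0\<close> by linarith
    next
      case True
      then have "\<zeta> = 0" using \<open>\<not> (M1 > 0 \<and> \<zeta> > 0)\<close> nonneg by auto
      then have "P > 0" and u0: "\<bar>u 0 - u' 0\<bar> < B" using strict by auto
      have B': "B = P + U"
        unfolding B \<open>\<zeta> = 0\<close> using \<open>\<zeta> + \<eta> < 1\<close> \<open>\<zeta> = 0\<close> by simp
      show ?thesis
      \<comment> \<open>For \<open>x = 0\<close> the maximiser is the node \<open>t (j - 1)\<close>: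
        the value there is at most \<open>U < B\<close> if \<open>j > 1\<close>, and
        \<open>j = 1\<close> is the assumption on \<open>u 0\<close>. For \<open>x > 0\<close> the
        slope term \<open>P * (1 - x)\<close> falls below \<open>P\<close>.\<close>
      proof (cases "x = 0")
        case True
        then have "partition_map N t j x = t (j - 1)" using t by (simp add: partition_map_def)
        then have "M1 = \<bar>u (j - 1) - u' (j - 1)\<bar>"
          using fif j unfolding M1 by (auto simp: vector_fif_def D1_def)
        moreover have "\<bar>u (j - 1) - u' (j - 1)\<bar> \<le> U" if "j \<noteq> 1"
          using U[of "j - 1"] j that by force
        ultimately show ?thesis
          using u0 B' \<open>P > 0\<close> by (cases "j = 1") auto
      next
        case False
        then have "P * (1 - x) < P" using \<open>P > 0\<close> x by (simp add: algebra_simps)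
        then show ?thesis using M1_le B' \<open>\<zeta> = 0\<close> by simp
      qed
    qed
  qed
  then show ?thesis using le unfolding M1_def D1_def by blast
qed

end
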